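(* For an integer $n\ge 1$ define $$f(n)=\begin{cases} 2k+1 & \text{if } n=4k,\\ 2k+2 & \text{if } n=4k+1,\\ 2k+3 & \text{if } n=4k+2 \text{ or } n=4k+3,\end{cases}$$ where $k$ is a nonnegative integer. Then $\gamma_s(\mu(P_n)) = f(n)$ for every $n\ge 1$, and $\gamma_s(\mu(C_n)) = f(n)$ for every $n\ge 3$; in particular $\gamma_s(\mu(P_n))=\gamma_s(\mu(C_n))$ for $n \ge 3$.
   Context: All graphs are finite, simple, undirected, with nonempty vertex set. $P_n$ denotes the path on $n$ vertices and $C_n$ the cycle on $n$ vertices. A set $S\subseteq V(G)$ is a dominating set of $G$ if every vertex of $V(G)\setminus S$ is adjacent to some vertex of $S$. A dominating set $S$ is a secure dominating set of $G$ if for every $u\in V(G)\setminus S$ there is $v\in S$ adjacent to $u$ such that $(S\setminus\{v\})\cup\{u\}$ is a dominating set of $G$. The secure domination number $\gamma_s(G)$ is the minimum cardinality of a secure dominating set of $G$. For a graph $G$ with vertices $v_1,\dots,v_n$, the Mycielskian $\mu(G)$ is the graph with vertex set $\{v_1,\dots,v_n,u_1,\dots,u_n,w\}$ ($2n+1$ distinct vertices) whose edges are: all edges of $G$; the edges $wu_i$ for $1\le i\le n$; and, for each edge $v_iv_j$ of $G$, the edges $u_iv_j$ and $v_iu_j$. *)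

theory Defs
  imports "Graph_Theory.Pair_Digraph"
begin

text \<open>
  Finite simple undirected graphs are the graphs of the locale \<^locale>\<open>pair_graph\<close>: an
  undirected edge between x and y is represented by the two arcs (x, y) and (y, x).
\<close>

definition dominating_set :: "'a pair_pre_digraph \<Rightarrow> 'a set \<Rightarrow> bool" where
  "dominating_set G S \<longleftrightarrow>
     S \<subseteq> pverts G \<and> (\<forall>u \<in> pverts G - S. \<exists>v \<in> S. (u, v) \<in> parcs G)"

definition secure_dominating_set :: "'a pair_pre_digraph \<Rightarrow> 'a set \<Rightarrow> bool" where
  "secure_dominating_set G S \<longleftrightarrow>
     dominating_set G S \<and>
     (\<forall>u \<in> pverts G - S. \<exists>v \<in> S. (u, v) \<in> parcs G \<and> dominating_set G ((S - {v}) \<union> {u}))"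

definition secure_domination_number :: "'a pair_pre_digraph \<Rightarrow> nat" where
  "secure_domination_number G = Min (card ` {S. secure_dominating_set G S})"

definition path_graph :: "nat \<Rightarrow> nat pair_pre_digraph" where
  "path_graph n =
     \<lparr> pverts = {..<n},
       parcs = {(i, j). i < n \<and> j < n \<and> (j = i + 1 \<or> i = j + 1)} \<rparr>"

text \<open>The following is a simple graph, namely the cycle on n vertices, only for \<open>n \<ge> 3\<close>.\<close>

definition cycle_graph :: "nat \<Rightarrow> nat pair_pre_digraph" where
  "cycle_graph n =
     \<lparr> pverts = {..<n},
       parcs = {(i, j). i < n \<and> j < n \<and> (j = (i + 1) mod n \<or> i = (j + 1) mod n)} \<rparr>"

text \<open>
  Vertices of the Mycielskian: \<open>Orig v\<close> is the original vertex v, \<open>Twin v\<close> is its copy u, and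
  \<open>Apex\<close> is the additional vertex w.
\<close>

datatype 'a myc_vertex = Orig 'a | Twin 'a | Apex

definition mycielskian :: "'a pair_pre_digraph \<Rightarrow> 'a myc_vertex pair_pre_digraph" where
  "mycielskian G =
     \<lparr> pverts = Orig ` pverts G \<union> Twin ` pverts G \<union> {Apex},
       parcs =
         {(Orig x, Orig y) | x y. (x, y) \<in> parcs G} \<union>
         {(Twin x, Orig y) | x y. (x, y) \<in> parcs G} \<union>
         {(Orig x, Twin y) | x y. (x, y) \<in> parcs G} \<union>
         {(Apex, Twin x) | x. x \<in> pverts G} \<union>
         {(Twin x, Apex) | x. x \<in> pverts G} \<rparr>"

text \<open>Here \<open>n div 4\<close> is the number k with \<open>n = 4 * k + r\<close> and \<open>r < 4\<close>.\<close>

definition myc_value :: "nat \<Rightarrow> nat" where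
  "myc_value n =
     (let k = n div 4 in
      if n mod 4 = 0 then 2 * k + 1
      else if n mod 4 = 1 then 2 * k + 2
      else 2 * k + 3)"

lemma myc_value_simps:
  "myc_value (4 * k) = 2 * k + 1"
  "myc_value (4 * k + 1) = 2 * k + 2"
  "myc_value (4 * k + 2) = 2 * k + 3"
  "myc_value (4 * k + 3) = 2 * k + 3"
proof -
  have "(4 * k + r) div 4 = k" "(4 * k + r) mod 4 = r" if "r < 4" for r
    using that by auto
  from this[of 0] this[of 1] this[of 2] this[of 3]
  show "myc_value (4 * k) = 2 * k + 1" "myc_value (4 * k + 1) = 2 * k + 2"
    "myc_value (4 * k + 2) = 2 * k + 3" "myc_value (4 * k + 3) = 2 * k + 3"
    unfolding myc_value_def Let_def by simp_all
qed

lemma pair_graphI: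
  assumes "finite (pverts G)" and "parcs G \<subseteq> pverts G \<times> pverts G"
    and "sym (parcs G)" and "irrefl (parcs G)"
  shows "pair_graph G"
proof -
  have "finite (parcs G)"
    using assms(1,2) by (meson finite_SigmaI finite_subset)
  then show ?thesis
    using assms by unfold_locales (auto simp: symmetric_def irrefl_def)
qed

lemma pair_graph_path_graph: "pair_graph (path_graph n)"
  by (rule pair_graphI) (auto simp: path_graph_def sym_def irrefl_def)

lemma pair_graph_cycle_graph:
  assumes "n \<ge> 3"
  shows "pair_graph (cycle_graph n)"
proof (rule pair_graphI)
  have "(i + 1) mod n \<noteq> i" if "i < n" for i
    using that assms by (cases "i + 1 = n") auto
  then show "irrefl (parcs (cycle_graph n))"
    by (force simp: cycle_graph_def irrefl_def)
qed (auto simp: cycle_graph_def sym_def)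

lemma pair_graph_mycielskian:
  assumes "pair_graph G"
  shows "pair_graph (mycielskian G)"
proof -
  interpret pair_graph G by fact
  have sym: "(y, x) \<in> parcs G" if "(x, y) \<in> parcs G" for x y
    using that pair_sym_arcs by (auto simp: symmetric_def dest: symD)
  show ?thesis
    by (rule pair_graphI)
      (auto simp: mycielskian_def sym_def irrefl_def intro: sym
        dest: in_arcsD1 in_arcsD2 no_loops')
qed

lemma card_pverts_mycielskian:
  assumes "finite (pverts G)"
  shows "card (pverts (mycielskian G)) = 2 * card (pverts G) + 1"
proof -
  have "card (Orig ` pverts G \<union> Twin ` pverts G) = card (pverts G) + card (pverts G)"
    using assms by (subst card_Un_disjoint) (auto simp: card_image inj_on_def)
  moreover have "Apex \<notin> Orig ` pverts G \<union> Twin ` pverts G"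
    by auto
  ultimately show ?thesis
    using assms by (simp add: mycielskian_def)
qed

text \<open>The minimum in \<^const>\<open>secure_domination_number\<close> is over a finite nonempty set.\<close>

lemma secure_domination_number_attained:
  assumes "finite (pverts G)"
  shows "\<exists>S. secure_dominating_set G S \<and> card S = secure_domination_number G"
    and "secure_dominating_set G S \<Longrightarrow> secure_domination_number G \<le> card S"
proof -
  have "{S. secure_dominating_set G S} \<subseteq> Pow (pverts G)"
    by (auto simp: secure_dominating_set_def dominating_set_def)
  then have fin: "finite {S. secure_dominating_set G S}"
    using assms by (meson finite_Pow_iff finite_subset)
  have "secure_dominating_set G (pverts G)"
    by (auto simp: secure_dominating_set_def dominating_set_def)
  then have "secure_domination_number G \<in> card ` {S. secure_dominating_set G S}"
    unfolding secure_domination_number_def using fin by (intro Min_in) auto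
  then show "\<exists>S. secure_dominating_set G S \<and> card S = secure_domination_number G"
    by force
  show "secure_domination_number G \<le> card S" if "secure_dominating_set G S"
    unfolding secure_domination_number_def using fin that by (intro Min_le) auto
qed

end

theory Submission
  imports Defs
begin

text \<open>
  Upper bound. If \<open>T\<close> is a secure dominating set of \<open>G\<close> in which, moreover, every vertex of \<open>G\<close>
  has a neighbour, then the originals of \<open>T\<close> together with the apex securely dominate the
  Mycielskian: an original is defended as in \<open>G\<close>, a twin is defended by the apex
  (\<open>secure_dominating_set_mycielskian\<close>). On a path with at least two vertices such a \<open>T\<close> consists
  of the two middle vertices of each block of four, corrected at the right end (\<open>path_set\<close>). The path is a spanning subgraph of the
  cycle, and adding arcs keeps a set securely dominating, so upper bounds pass from paths to cycles
  and lower bounds from cycles to paths. Hence the lower bound is needed only for cycles and for the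
  paths on one and two vertices.

  Lower bound. Let \<open>S\<close> be secure dominating, \<open>A\<close> and \<open>B\<close> the vertices whose original, respectively
  twin, is in \<open>S\<close>, and let \<open>d v\<close> count the neighbours of \<open>v\<close> in \<open>A\<close>. In a 2-regular graph on \<open>n\<close>
  vertices the sum of all \<open>d v\<close> is \<open>2 * card A\<close>. Every twin outside \<open>S\<close> is dominated by an original or
  by the apex, which almost gives \<open>d v \<ge> 1\<close> off \<open>B\<close>; security supplies the remaining surplus, and the
  result is \<open>n + 2 \<le> 2 * card S\<close> (\<open>card_lower_bound\<close>).

  This settles every residue of \<open>n\<close> modulo 4 except 2, where the claimed value is larger by one and
  equality \<open>n + 2 = 2 * card S\<close> has to be excluded. Without triangles and 4-cycles, and with at least
  five vertices, equality forces \<open>d v = 1\<close> everywhere (\<open>tight_perfect\<close>). On a cycle this means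
  that membership in \<open>A\<close> flips with every step of length two; for \<open>n\<close> congruent to 2 modulo 4 an odd
  number of such steps leads back to the start, which is absurd (\<open>cycle_perfect_not_2_mod_4\<close>).
\<close>

section \<open>Domination in the Mycielskian\<close>

definition nbrs :: "'a pair_pre_digraph \<Rightarrow> 'a \<Rightarrow> 'a set" where
  "nbrs G v = {x. (v, x) \<in> parcs G}"

lemma pverts_mycielskian:
  "pverts (mycielskian G) = Orig ` pverts G \<union> Twin ` pverts G \<union> {Apex}"
  by (simp add: mycielskian_def)

lemma parcs_mycielskian_iff [simp]:
  "(Orig x, Orig y) \<in> parcs (mycielskian G) \<longleftrightarrow> (x, y) \<in> parcs G"
  "(Orig x, Twin y) \<in> parcs (mycielskian G) \<longleftrightarrow> (x, y) \<in> parcs G"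
  "(Twin x, Orig y) \<in> parcs (mycielskian G) \<longleftrightarrow> (x, y) \<in> parcs G"
  "(Twin x, Twin y) \<notin> parcs (mycielskian G)"
  "(Twin x, Apex) \<in> parcs (mycielskian G) \<longleftrightarrow> x \<in> pverts G"
  "(Apex, Twin x) \<in> parcs (mycielskian G) \<longleftrightarrow> x \<in> pverts G"
  "(Orig x, Apex) \<notin> parcs (mycielskian G)"
  "(Apex, Orig x) \<notin> parcs (mycielskian G)"
  "(Apex, Apex) \<notin> parcs (mycielskian G)"
  by (auto simp: mycielskian_def)

text \<open>
  One condition for each of the three kinds of vertices to be dominated. A neighbour of an original
  may be an original or a twin, one of a twin an original or the apex, one of the apex a twin.
\<close>

lemma dominating_set_mycielskian_iff:
  "dominating_set (mycielskian G) S \<longleftrightarrow>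
     S \<subseteq> pverts (mycielskian G) \<and>
     (\<forall>x\<in>pverts G. Orig x \<in> S \<or> (\<exists>y\<in>nbrs G x. Orig y \<in> S \<or> Twin y \<in> S)) \<and>
     (\<forall>x\<in>pverts G. Twin x \<in> S \<or> Apex \<in> S \<or> (\<exists>y\<in>nbrs G x. Orig y \<in> S)) \<and>
     (Apex \<in> S \<or> (\<exists>x\<in>pverts G. Twin x \<in> S))"
  (is "?D \<longleftrightarrow> ?sub \<and> ?orig \<and> ?twin \<and> ?apex")
proof -
  have ex_split: "(\<exists>v\<in>S. P v) \<longleftrightarrow>
      (\<exists>y. Orig y \<in> S \<and> P (Orig y)) \<or> (\<exists>y. Twin y \<in> S \<and> P (Twin y)) \<or> (Apex \<in> S \<and> P Apex)"
    for P :: "'a myc_vertex \<Rightarrow> bool"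
    by (metis myc_vertex.exhaust)
  have "?D \<longleftrightarrow> ?sub \<and> (\<forall>u\<in>pverts (mycielskian G). u \<in> S \<or> (\<exists>v\<in>S. (u, v) \<in> parcs (mycielskian G)))"
    by (auto simp: dominating_set_def)
  also have "\<dots> \<longleftrightarrow> ?sub \<and> ?orig \<and> ?twin \<and> ?apex"
    unfolding ex_split by (auto simp: pverts_mycielskian nbrs_def)
  finally show ?thesis .
qed

lemma secure_dominating_set_spanning_subgraph:
  assumes "pverts H = pverts G" and "parcs H \<subseteq> parcs G" and "secure_dominating_set H S"
  shows "secure_dominating_set G S"
proof -
  have "dominating_set G T" if "dominating_set H T" for T
    using that assms(1,2) unfolding dominating_set_def by blast
  then show ?thesis
    using assms unfolding secure_dominating_set_def by (metis subsetD)
qed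

lemma card_mycielskian_set:
  assumes "finite S"
  shows "card S = card (Orig -` S) + card (Twin -` S) + of_bool (Apex \<in> S)"
proof -
  have split: "S = (Orig ` (Orig -` S) \<union> Twin ` (Twin -` S)) \<union> (S \<inter> {Apex})"
    (is "S = (?A \<union> ?B) \<union> ?C")
    by (auto simp: image_iff) (metis myc_vertex.exhaust)
  have "card ((?A \<union> ?B) \<union> ?C) = card (?A \<union> ?B) + card ?C"
    by (rule card_Un_disjoint) (use assms in \<open>auto simp: finite_vimageI inj_on_def\<close>)
  also have "card (?A \<union> ?B) = card ?A + card ?B"
    by (rule card_Un_disjoint) (use assms in \<open>auto simp: finite_vimageI inj_on_def\<close>)
  also have "card ?A = card (Orig -` S)"
    by (rule card_image) (simp add: inj_on_def)
  also have "card ?B = card (Twin -` S)"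
    by (rule card_image) (simp add: inj_on_def)
  also have "card ?C = of_bool (Apex \<in> S)"
    by auto
  finally show ?thesis
    using split by simp
qed

section \<open>What security forces on originals and twins\<close>

locale mycielskian_secure = pair_graph G for G :: "'a pair_pre_digraph" +
  fixes S :: "'a myc_vertex set"
  assumes secure: "secure_dominating_set (mycielskian G) S"
begin

abbreviation A :: "'a set" where "A \<equiv> Orig -` S"
abbreviation B :: "'a set" where "B \<equiv> Twin -` S"

lemma dominating: "dominating_set (mycielskian G) S"
  using secure by (simp add: secure_dominating_set_def)

lemma AB_subset: "A \<subseteq> pverts G" "B \<subseteq> pverts G"
  using dominating by (auto simp: dominating_set_def pverts_mycielskian)

lemma finite_AB [simp]: "finite A" "finite B"
  by (rule finite_subset[OF AB_subset(1) pair_finite_verts],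
      rule finite_subset[OF AB_subset(2) pair_finite_verts])

lemma nbrs_subset: "nbrs G v \<subseteq> pverts G"
  by (auto simp: nbrs_def dest: in_arcsD2)

lemma finite_nbrs [simp]: "finite (nbrs G v)"
  using nbrs_subset pair_finite_verts by (rule finite_subset)

lemma nbrs_sym: "x \<in> nbrs G v \<longleftrightarrow> v \<in> nbrs G x"
  using pair_sym_arcs by (auto simp: nbrs_def symmetric_def dest: symD)

lemma nbrs_irrefl: "v \<notin> nbrs G v"
  by (auto simp: nbrs_def dest: no_loops')

lemma card_S: "card S = card A + card B + of_bool (Apex \<in> S)"
proof (rule card_mycielskian_set)
  have "finite (pverts (mycielskian G))"
    using pair_finite_verts by (simp add: pverts_mycielskian)
  then show "finite S"
    using dominating finite_subset by (auto simp: dominating_set_def)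
qed

text \<open>
  All lower bounds rest on the defence of twins: a twin is adjacent only to the apex and to the
  originals of the neighbours of its vertex, so there are two kinds of defence.
\<close>

lemma twin_defended:
  assumes "i \<in> pverts G" "i \<notin> B"
  obtains (Apex) "Apex \<in> S" "dominating_set (mycielskian G) (S - {Apex} \<union> {Twin i})"
    | (Orig) j where "j \<in> A" "j \<in> nbrs G i"
        "dominating_set (mycielskian G) (S - {Orig j} \<union> {Twin i})"
proof -
  have "Twin i \<in> pverts (mycielskian G) - S"
    using assms by (simp add: pverts_mycielskian)
  then obtain v where v: "v \<in> S" "(Twin i, v) \<in> parcs (mycielskian G)"
      "dominating_set (mycielskian G) (S - {v} \<union> {Twin i})"
    using secure unfolding secure_dominating_set_def by blast
  show ?thesis
  proof (cases v)
    case (Orig j)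
    with v show ?thesis by (intro that(2)) (auto simp: nbrs_def)
  next
    case Apex
    with v show ?thesis by (intro that(1)) auto
  qed (use v in auto)
qed

subsection \<open>The apex is not chosen\<close>

lemma no_apex_twins:
  assumes "Apex \<notin> S"
  shows "B \<noteq> {}"
  using dominating assms by (auto simp: dominating_set_mycielskian_iff)

lemma no_apex_covered:
  assumes "Apex \<notin> S" "i \<in> pverts G" "i \<notin> B"
  shows "nbrs G i \<inter> A \<noteq> {}"
  using dominating assms unfolding dominating_set_mycielskian_iff by blast

text \<open>
  When the original of \<open>j\<close> moves to the twin of \<open>i\<close>, the twins of the other neighbours of \<open>j\<close> lose a
  dominator, and without the apex each of them needs a second one.
\<close>

lemma no_apex_defended:
  assumes "Apex \<notin> S" "i \<in> pverts G" "i \<notin> B"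
  obtains j where "j \<in> nbrs G i \<inter> A"
    and "\<And>i'. i' \<in> nbrs G j \<Longrightarrow> i' \<noteq> i \<Longrightarrow> i' \<notin> B \<Longrightarrow> nbrs G i' \<inter> A - {j} \<noteq> {}"
  using assms(2,3)
proof (cases rule: twin_defended)
  case (Orig j)
  show ?thesis
  proof (rule that)
    show "j \<in> nbrs G i \<inter> A" using Orig by auto
    show "nbrs G i' \<inter> A - {j} \<noteq> {}" if "i' \<in> nbrs G j" "i' \<noteq> i" "i' \<notin> B" for i'
    proof -
      have "i' \<in> pverts G" using that(1) nbrs_subset by auto
      then have "\<exists>y\<in>nbrs G i'. Orig y \<in> S - {Orig j} \<union> {Twin i}"
        using Orig(3) that(2,3) assms(1) unfolding dominating_set_mycielskian_iff by auto
      then show ?thesis by auto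
    qed
  qed
qed (use assms in auto)

subsection \<open>The apex is chosen\<close>

text \<open>
  The twin of \<open>u\<close> is outside \<open>S\<close> and no original dominates it, so that the apex has to.
\<close>

definition exposed :: "'a \<Rightarrow> bool" where
  "exposed u \<longleftrightarrow> u \<in> pverts G \<and> u \<notin> B \<and> nbrs G u \<inter> A = {}"

text \<open>
  Only the apex is available to defend an exposed twin.
\<close>

lemma exposed_swap:
  assumes "exposed u"
  shows "dominating_set (mycielskian G) (S - {Apex} \<union> {Twin u})"
  using assms unfolding exposed_def by (elim conjE) (erule twin_defended, auto)

text \<open>
  Once the apex has moved to the exposed twin it dominates no other twin.
\<close>

lemma exposed_unique:
  assumes "exposed u" "i \<in> pverts G" "i \<notin> B" "i \<noteq> u"
  shows "nbrs G i \<inter> A \<noteq> {}"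
  using exposed_swap[OF assms(1)] assms(2-4) unfolding dominating_set_mycielskian_iff by blast

lemma exposed_dominated:
  assumes "exposed u"
  shows "u \<in> A \<or> nbrs G u \<inter> B \<noteq> {}"
proof -
  have "u \<in> pverts G" using assms by (simp add: exposed_def)
  then have "Orig u \<in> S \<or> (\<exists>y\<in>nbrs G u. Orig y \<in> S \<or> Twin y \<in> S \<or> y = u)"
    using exposed_swap[OF assms] unfolding dominating_set_mycielskian_iff by blast
  then show ?thesis
    using assms nbrs_irrefl by (auto simp: exposed_def)
qed

text \<open>
  The twin of \<open>i\<close> cannot be defended by the apex, which would uncover the twin of \<open>u\<close>. So the
  original of a neighbour \<open>j\<close> of \<open>i\<close> moves there. As \<open>i\<close> is not in \<open>A\<close> and a twin is not adjacent to
  its own original, the original of \<open>i\<close> then needs a dominator other than the original of \<open>j\<close>.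
\<close>

lemma exposed_nbr:
  assumes "exposed u" "i \<in> nbrs G u" "i \<notin> B"
  shows "card (nbrs G i \<inter> A) \<ge> 2 \<or> nbrs G i \<inter> B \<noteq> {}"
proof -
  have i: "i \<in> pverts G" "i \<noteq> u" "i \<notin> A"
    using assms nbrs_subset nbrs_irrefl by (auto simp: exposed_def)
  show ?thesis
    using i(1) assms(3)
  proof (cases rule: twin_defended)
    case Apex
    then have "\<exists>y\<in>nbrs G u. Orig y \<in> S"
      using assms(1) i(2) unfolding dominating_set_mycielskian_iff exposed_def by blast
    then show ?thesis using assms(1) by (auto simp: exposed_def)
  next
    case (Orig j)
    let ?S' = "S - {Orig j} \<union> {Twin i}"
    have "Orig i \<in> ?S' \<or> (\<exists>y\<in>nbrs G i. Orig y \<in> ?S' \<or> Twin y \<in> ?S')"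
      using Orig(3) i(1) unfolding dominating_set_mycielskian_iff by blast
    then have "\<exists>y\<in>nbrs G i. (Orig y \<in> S \<and> y \<noteq> j) \<or> Twin y \<in> S \<or> y = i"
      using i(3) by auto
    then obtain y where y: "y \<in> nbrs G i" "(y \<in> A \<and> y \<noteq> j) \<or> y \<in> B"
      using nbrs_irrefl by blast
    show ?thesis
    proof (cases "y \<in> B")
      case False
      then have "{j, y} \<subseteq> nbrs G i \<inter> A" "card {j, y} = 2"
        using y Orig(1,2) by auto
      then show ?thesis
        by (metis card_mono finite_Int finite_nbrs)
    qed (use y in auto)
  qed
qed

end

section \<open>Counting in 2-regular graphs\<close>

locale mycielskian_secure_2_regular = mycielskian_secure +
  assumes regular: "v \<in> pverts G \<Longrightarrow> card (nbrs G v) = 2"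
begin

abbreviation d :: "'a \<Rightarrow> nat" where "d v \<equiv> card (nbrs G v \<inter> A)"

lemma sum_d: "(\<Sum>v\<in>pverts G. d v) = 2 * card A"
proof -
  have "(\<Sum>v\<in>pverts G. card {x \<in> A. x \<in> nbrs G v}) = 2 * card A"
  proof (rule sum_multicount)
    show "\<forall>x\<in>A. card {v \<in> pverts G. x \<in> nbrs G v} = 2"
    proof
      fix x assume "x \<in> A"
      have "{v \<in> pverts G. x \<in> nbrs G v} = nbrs G x"
        using nbrs_sym nbrs_subset by auto
      then show "card {v \<in> pverts G. x \<in> nbrs G v} = 2"
        using \<open>x \<in> A\<close> AB_subset(1) regular by auto
    qed
  qed (auto simp: pair_finite_verts)
  moreover have "{x \<in> A. x \<in> nbrs G v} = nbrs G v \<inter> A" for v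
    by auto
  ultimately show ?thesis
    by simp
qed

lemma sum_of_bool_notin:
  assumes "X \<subseteq> pverts G"
  shows "(\<Sum>v\<in>pverts G. of_bool (v \<notin> X)) = card (pverts G) - card X"
proof -
  have "(\<Sum>v\<in>pverts G. of_bool (v \<notin> X)) = card (pverts G - X)"
    using pair_finite_verts by (simp add: Int_def set_diff_eq)
  also have "\<dots> = card (pverts G) - card X"
    using assms finite_subset[OF assms pair_finite_verts] by (simp add: card_Diff_subset)
  finally show ?thesis .
qed

lemma d_pos_iff: "d v > 0 \<longleftrightarrow> nbrs G v \<inter> A \<noteq> {}"
  by (simp add: card_gt_0_iff)

text \<open>
  The second part says that equality leaves no slack: \<open>d\<close> then agrees with its lower bound
  pointwise. The exceptional set \<open>X\<close> will be \<open>B\<close>, or \<open>B\<close> with one exposed vertex, or empty.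
\<close>

lemma covered_count:
  assumes "X \<subseteq> pverts G" and "\<And>v. v \<in> pverts G \<Longrightarrow> v \<notin> X \<Longrightarrow> nbrs G v \<inter> A \<noteq> {}"
  shows "card (pverts G) \<le> 2 * card A + card X"
    and "card (pverts G) = 2 * card A + card X \<Longrightarrow> v \<in> pverts G \<Longrightarrow> d v = of_bool (v \<notin> X)"
proof -
  have le: "of_bool (v \<notin> X) \<le> d v" if "v \<in> pverts G" for v
    using assms(2)[OF that] d_pos_iff[of v] by auto
  then have "(\<Sum>v\<in>pverts G. of_bool (v \<notin> X)) \<le> (\<Sum>v\<in>pverts G. d v)"
    by (rule sum_mono)
  then show "card (pverts G) \<le> 2 * card A + card X"
    unfolding sum_of_bool_notin[OF assms(1)] sum_d by linarith
  assume eq: "card (pverts G) = 2 * card A + card X" and v: "v \<in> pverts G"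
  have "(\<Sum>v\<in>pverts G. of_bool (v \<notin> X)) = (\<Sum>v\<in>pverts G. d v)"
    unfolding sum_of_bool_notin[OF assms(1)] sum_d using eq by linarith
  from sum_mono_inv[OF this le v pair_finite_verts] show "d v = of_bool (v \<notin> X)"
    by simp
qed

text \<open>
  Under equality some \<open>i\<close> off \<open>B\<close> is defended from \<open>j\<close>, whose other neighbour \<open>i'\<close> would have to be
  in \<open>B\<close>, where \<open>d\<close> vanishes, or have \<open>d i' \<ge> 2\<close>; both contradict the pointwise values of \<open>d\<close>.
\<close>

lemma no_apex_count:
  assumes "Apex \<notin> S" and "card B < card (pverts G)"
  shows "card (pverts G) < 2 * card A + card B"
proof (rule ccontr)
  assume "\<not> ?thesis"
  then have tight: "card (pverts G) = 2 * card A + card B"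
    using covered_count(1)[OF AB_subset(2) no_apex_covered[OF assms(1)]] by linarith
  have d: "d v = of_bool (v \<notin> B)" if "v \<in> pverts G" for v
    using covered_count(2)[OF AB_subset(2) no_apex_covered[OF assms(1)] tight that] .
  obtain i where i: "i \<in> pverts G" "i \<notin> B"
    using assms(2) AB_subset(2) by (metis less_irrefl subsetI subset_antisym)
  obtain j where j: "j \<in> nbrs G i \<inter> A"
    and i': "\<And>i'. i' \<in> nbrs G j \<Longrightarrow> i' \<noteq> i \<Longrightarrow> i' \<notin> B \<Longrightarrow> nbrs G i' \<inter> A - {j} \<noteq> {}"
    using no_apex_defended[OF assms(1) i] by blast
  have "card (nbrs G j) = 2" using j AB_subset regular by auto
  then obtain i' where *: "i' \<in> nbrs G j" "i' \<noteq> i"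
    by (metis card_2_iff')
  have ji': "j \<in> nbrs G i' \<inter> A" "i' \<in> pverts G"
    using * j nbrs_sym nbrs_subset by auto
  then have "i' \<notin> B"
    using d[OF ji'(2)] d_pos_iff[of i'] by auto
  then have "d i' = 1" using d[OF ji'(2)] by simp
  then have "nbrs G i' \<inter> A = {j}"
    using ji'(1) by (metis card_1_singletonE singletonD)
  then show False using i'[OF * \<open>i' \<notin> B\<close>] by simp
qed

text \<open>
  An exposed vertex \<open>u\<close> costs one in the count, but with \<open>B\<close> empty each of its two neighbours has two
  neighbours in \<open>A\<close>, which gains two.
\<close>

lemma exposed_count:
  assumes "exposed u" "B = {}"
  shows "card (pverts G) + 1 \<le> 2 * card A"
proof -
  have u: "u \<in> pverts G" and "u \<in> A"
    using assms exposed_dominated[OF assms(1)] by (auto simp: exposed_def)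
  have sub: "insert u (nbrs G u) \<subseteq> pverts G"
    using u nbrs_subset by auto
  have "of_bool (v \<notin> {u}) + of_bool (v \<in> nbrs G u) \<le> d v" if "v \<in> pverts G" for v
  proof (cases "v \<in> nbrs G u")
    case True
    then have "2 \<le> d v" using exposed_nbr[OF assms(1) True] assms(2) by auto
    then show ?thesis using True nbrs_irrefl by (auto simp: of_bool_def)
  next
    case False
    then show ?thesis
      using exposed_unique[OF assms(1) that] d_pos_iff[of v] assms(2) by (cases "v = u") auto
  qed
  then have "(\<Sum>v\<in>pverts G. of_bool (v \<notin> {u}) + of_bool (v \<in> nbrs G u)) \<le> (\<Sum>v\<in>pverts G. d v)"
    by (rule sum_mono)
  moreover have "(\<Sum>v\<in>pverts G. of_bool (v \<in> nbrs G u)) = card (nbrs G u)"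
    using pair_finite_verts nbrs_subset[of u] by (simp add: Int_absorb1 Int_def[symmetric])
  moreover have "card (pverts G) > 0"
    using u pair_finite_verts by (auto simp: card_gt_0_iff)
  ultimately show ?thesis
    using sum_of_bool_notin[of "{u}"] u regular[OF u] sum_d
    by (simp only: sum.distrib) simp
qed

text \<open>
  If the apex is in \<open>S\<close>, it contributes the difference of two. The loss of one caused by an exposed
  vertex is compensated by an element of \<open>B\<close>, counted twice in \<open>2 * card S\<close> but only once in
  \<open>covered_count\<close>, or by \<open>exposed_count\<close>. If the apex is not in \<open>S\<close>, two elements of \<open>B\<close> make up the
  difference in the same way; a single one does so together with the strictness of \<open>no_apex_count\<close>.
\<close>

lemma card_lower_bound:
  assumes "card (pverts G) \<ge> 2"
  shows "card (pverts G) + 2 \<le> 2 * card S"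
proof (cases "Apex \<in> S")
  case False
  show ?thesis
  proof (cases "card B \<ge> 2")
    case True
    then show ?thesis
      using covered_count(1)[OF AB_subset(2) no_apex_covered[OF False]] card_S by simp
  next
    case small: False
    have "card B > 0" using no_apex_twins[OF False] by (simp add: card_gt_0_iff)
    then show ?thesis using no_apex_count[OF False] small card_S assms by simp
  qed
next
  case True
  show ?thesis
  proof (cases "\<exists>u. exposed u")
    case False
    then have "card (pverts G) \<le> 2 * card A + card B"
      by (intro covered_count(1) AB_subset) (auto simp: exposed_def)
    then show ?thesis using card_S True by simp
  next
    case exposed: True
    then obtain u where u: "exposed u" by blast
    have "card (pverts G) \<le> 2 * card A + card (insert u B)"
      by (rule covered_count(1))
        (use u AB_subset(2) exposed_unique[OF u] in \<open>auto simp: exposed_def\<close>)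
    also have "card (insert u B) = card B + 1"
      using u by (simp add: exposed_def)
    finally have "card (pverts G) \<le> 2 * card A + card B + 1" by simp
    moreover have "card B > 0" if "B \<noteq> {}" using that by (simp add: card_gt_0_iff)
    ultimately show ?thesis
      using exposed_count[OF u] card_S True by (cases "B = {}") auto
  qed
qed

text \<open>
  Equality in \<open>card_lower_bound\<close> leaves \<open>B\<close> with at most one element, and the total surplus of \<open>d\<close> over
  its pointwise lower bound is then at most one.
  In the case \<open>no_apex\<close> the surplus one sits at a vertex \<open>x\<close> different from the vertex \<open>\<beta>\<close> of \<open>B\<close>; in
  the case \<open>exposed\<close> there is no surplus.
\<close>

lemma tight_cases:
  assumes "2 * card S = card (pverts G) + 2" and "card (pverts G) > 2"
  obtains (perfect) "\<And>v. v \<in> pverts G \<Longrightarrow> d v = 1"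
    | (no_apex) \<beta> x where "Apex \<notin> S" "B = {\<beta>}" "x \<in> pverts G" "x \<noteq> \<beta>"
        "\<And>v. v \<in> pverts G \<Longrightarrow> d v = of_bool (v \<noteq> \<beta>) + of_bool (v = x)"
    | (exposed) \<beta> u where "B = {\<beta>}" "exposed u"
        "\<And>v. v \<in> pverts G \<Longrightarrow> v \<noteq> u \<Longrightarrow> d v \<le> 1"
proof (cases "Apex \<in> S")
  case False
  have B: "card B > 0" using no_apex_twins[OF False] by (simp add: card_gt_0_iff)
  have *: "2 * card A + 2 * card B = card (pverts G) + 2" using assms card_S False by simp
  moreover have "card (pverts G) \<le> 2 * card A + card B"
    using covered_count(1)[OF AB_subset(2) no_apex_covered[OF False]] .
  ultimately have "card B < card (pverts G)" using assms(2) by linarith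
  from no_apex_count[OF False this] * B have b: "card B = 1" "2 * card A = card (pverts G)"
    by linarith+
  then obtain \<beta> where \<beta>: "B = {\<beta>}" by (meson card_1_singletonE)
  have \<beta>V: "\<beta> \<in> pverts G" using AB_subset(2) \<beta> by auto
  have cov: "d v \<ge> 1" if "v \<in> pverts G" "v \<noteq> \<beta>" for v
    using no_apex_covered[OF False that(1)] \<beta> that d_pos_iff[of v] by auto
  show ?thesis
  proof (cases "d \<beta> = 0")
    case False
    then have "\<And>v. v \<in> pverts G \<Longrightarrow> v \<notin> {} \<Longrightarrow> nbrs G v \<inter> A \<noteq> {}"
      using cov d_pos_iff by (metis One_nat_def Suc_le_eq neq0_conv)
    from covered_count(2)[where X = "{}", OF _ this] b(2) show ?thesis
      by (intro that(1)) simp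
  next
    case True
    have sum1: "(\<Sum>v\<in>pverts G - {\<beta>}. d v) = card (pverts G - {\<beta>}) + 1"
      using sum.remove[OF pair_finite_verts \<beta>V, of d] True sum_d b(2) assms(2)
        card_Diff_singleton[OF \<beta>V] by simp
    have "\<exists>x\<in>pverts G - {\<beta>}. d x > 1"
    proof (rule ccontr)
      assume "\<not> ?thesis"
      then have "(\<Sum>v\<in>pverts G - {\<beta>}. d v) \<le> (\<Sum>v\<in>pverts G - {\<beta>}. 1)"
        by (intro sum_mono) (metis One_nat_def not_less)
      then show False using sum1 by simp
    qed
    then obtain x where x: "x \<in> pverts G" "x \<noteq> \<beta>" "d x > 1" by auto
    have le: "of_bool (v \<noteq> \<beta>) + of_bool (v = x) \<le> d v" if "v \<in> pverts G" for v
      using cov[OF that] x by (cases "v = x"; cases "v = \<beta>") auto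
    have "(\<Sum>v\<in>pverts G. of_bool (v \<noteq> \<beta>) + of_bool (v = x)) = (\<Sum>v\<in>pverts G. d v)"
      using sum_of_bool_notin[of "{\<beta>}"] \<beta>V x sum_d b assms(2) pair_finite_verts
      by (simp add: sum.distrib)
    from sum_mono_inv[OF this le] have "d v = of_bool (v \<noteq> \<beta>) + of_bool (v = x)"
      if "v \<in> pverts G" for v
      using that pair_finite_verts by metis
    then show ?thesis using that(2) \<open>Apex \<notin> S\<close> \<beta> x by blast
  qed
next
  case True
  have *: "2 * card A + 2 * card B = card (pverts G)" using assms card_S True by simp
  show ?thesis
  proof (cases "\<exists>u. exposed u")
    case False
    then have cov: "\<And>v. v \<in> pverts G \<Longrightarrow> v \<notin> B \<Longrightarrow> nbrs G v \<inter> A \<noteq> {}"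
      by (auto simp: exposed_def)
    from covered_count(1)[OF AB_subset(2) cov] * have "card B = 0" by linarith
    then have "B = {}" by simp
    with covered_count(2)[OF AB_subset(2) cov] * show ?thesis
      by (intro that(1)) simp
  next
    case exposed: True
    then obtain u where u: "exposed u" by blast
    have ub: "insert u B \<subseteq> pverts G" "card (insert u B) = card B + 1"
      using u AB_subset(2) by (auto simp: exposed_def)
    have cov: "\<And>v. v \<in> pverts G \<Longrightarrow> v \<notin> insert u B \<Longrightarrow> nbrs G v \<inter> A \<noteq> {}"
      using exposed_unique[OF u] by auto
    have "B \<noteq> {}" using exposed_count[OF u] * by auto
    then have "card B > 0" by (simp add: card_gt_0_iff)
    then have b: "card B = 1" and tight: "card (pverts G) = 2 * card A + card (insert u B)"
      using covered_count(1)[OF ub(1) cov] ub(2) * by linarith+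
    obtain \<beta> where "B = {\<beta>}" using b by (meson card_1_singletonE)
    moreover have "d v \<le> 1" if "v \<in> pverts G" for v
      using covered_count(2)[OF ub(1) cov tight that] by simp
    ultimately show ?thesis using that(3) u by blast
  qed
qed

text \<open>
  The two other cases of \<open>tight_cases\<close> are excluded as follows. Without the apex, a vertex \<open>z\<close> other than
  \<open>\<beta>\<close> and \<open>x\<close> is defended from some \<open>j\<close> whose other neighbour must have \<open>d \<ge> 2\<close>, hence is \<open>x\<close>; so
  every such \<open>z\<close> is one of the at most two vertices at distance two from \<open>x\<close>, and the graph has at most
  four vertices. With an exposed vertex \<open>u\<close>, each neighbour of \<open>u\<close> other than \<open>\<beta>\<close> is adjacent to \<open>\<beta>\<close>,
  which closes a triangle if \<open>\<beta>\<close> is adjacent to \<open>u\<close> and a 4-cycle if not.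
\<close>

lemma tight_perfect:
  assumes tight: "2 * card S = card (pverts G) + 2" and large: "card (pverts G) > 4"
    and no_triangle: "\<And>u v. v \<in> nbrs G u \<Longrightarrow> nbrs G u \<inter> nbrs G v = {}"
    and no_square: "\<And>u v x y. u \<noteq> v \<Longrightarrow> x \<in> nbrs G u \<inter> nbrs G v \<Longrightarrow>
                      y \<in> nbrs G u \<inter> nbrs G v \<Longrightarrow> x = y"
    and v: "v \<in> pverts G"
  shows "d v = 1"
proof -
  have "card (pverts G) > 2" using large by simp
  with tight show ?thesis
  proof (cases rule: tight_cases)
    case perfect
    then show ?thesis using v by simp
  next
    case (no_apex \<beta> x)
    have "z \<in> {\<beta>, x} \<union> (\<Union>j\<in>nbrs G x. nbrs G j - {x})" if z: "z \<in> pverts G" for z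
    proof (rule ccontr)
      assume *: "\<not> ?thesis"
      then have "z \<notin> B" using no_apex(2) by auto
      then obtain j where j: "j \<in> nbrs G z \<inter> A"
        and i': "\<And>i'. i' \<in> nbrs G j \<Longrightarrow> i' \<noteq> z \<Longrightarrow> i' \<notin> B \<Longrightarrow> nbrs G i' \<inter> A - {j} \<noteq> {}"
        using no_apex_defended[OF no_apex(1) z] by blast
      have "card (nbrs G j) = 2" using j AB_subset regular by auto
      then obtain i where i: "i \<in> nbrs G j" "i \<noteq> z"
        by (metis card_2_iff')
      have ji: "j \<in> nbrs G i \<inter> A" "i \<in> pverts G"
        using i j nbrs_sym nbrs_subset by auto
      have "i \<noteq> \<beta>"
        using no_apex(4) no_apex(5)[OF ji(2)] d_pos_iff[of i] ji(1) by auto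
      moreover have "i \<noteq> x"
        using * j i(2) ji(1) nbrs_sym by auto
      ultimately have "d i = 1" "i \<notin> B"
        using no_apex(2) no_apex(5)[OF ji(2)] by auto
      then have "nbrs G i \<inter> A = {j}"
        using ji(1) by (metis card_1_singletonE singletonD)
      then show False using i'[OF i \<open>i \<notin> B\<close>] by simp
    qed
    then have "card (pverts G) \<le> card ({\<beta>, x} \<union> (\<Union>j\<in>nbrs G x. nbrs G j - {x}))"
      by (intro card_mono) auto
    also have "\<dots> \<le> card {\<beta>, x} + card (\<Union>j\<in>nbrs G x. nbrs G j - {x})"
      by (rule card_Un_le)
    also have "card {\<beta>, x} \<le> 2"
      by (simp add: card_insert_if)
    also have "card (\<Union>j\<in>nbrs G x. nbrs G j - {x}) \<le> (\<Sum>j\<in>nbrs G x. card (nbrs G j - {x}))"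
      by (rule card_UN_le) simp
    also have "\<dots> = (\<Sum>j\<in>nbrs G x. 1)"
    proof (rule sum.cong)
      fix j assume j: "j \<in> nbrs G x"
      then have "x \<in> nbrs G j" by (simp add: nbrs_sym)
      moreover have "card (nbrs G j) = 2" using j nbrs_subset regular by blast
      ultimately show "card (nbrs G j - {x}) = 1" by simp
    qed simp
    also have "\<dots> = 2"
      using regular[OF no_apex(3)] by simp
    finally show ?thesis using large by simp
  next
    case (exposed \<beta> u)
    have u: "u \<in> pverts G" "u \<noteq> \<beta>" using exposed by (auto simp: exposed_def)
    obtain p q where pq: "nbrs G u = {p, q}" "p \<noteq> q"
      using regular[OF u(1)] by (meson card_2_iff)
    have \<beta>: "\<beta> \<in> nbrs G y" if "y \<in> nbrs G u" "y \<noteq> \<beta>" for y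
    proof -
      have "y \<in> pverts G" "y \<noteq> u" using that nbrs_subset nbrs_irrefl by auto
      then have "\<not> d y \<ge> 2" using exposed(3)[of y] by simp
      then show ?thesis using exposed_nbr[OF exposed(2) that(1)] exposed(1) that(2) by auto
    qed
    have False
    proof (cases "\<beta> \<in> nbrs G u")
      case True
      then obtain y where "y \<in> nbrs G u" "y \<noteq> \<beta>" using pq by auto
      then show False using \<beta>[of y] no_triangle[of y u] True by auto
    next
      case False
      then have "p \<in> nbrs G u \<inter> nbrs G \<beta>" "q \<in> nbrs G u \<inter> nbrs G \<beta>"
        using \<beta>[of p] \<beta>[of q] pq nbrs_sym by auto
      then show False using no_square[OF u(2)] pq(2) by blast
    qed
    then show ?thesis ..
  qed
qed

end

section \<open>Cycles\<close>

lemma nbrs_cycle_graph: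
  assumes "n \<ge> 3" "v < n"
  shows "nbrs (cycle_graph n) v = {if v + 1 = n then 0 else v + 1, if v = 0 then n - 1 else v - 1}"
proof -
  have succ: "(i + 1) mod n = (if i + 1 = n then 0 else i + 1)" if "i < n" for i
    using that by simp
  have iff: "x \<in> nbrs (cycle_graph n) v \<longleftrightarrow>
      x < n \<and> (x = (if v + 1 = n then 0 else v + 1) \<or> v = (if x + 1 = n then 0 else x + 1))" for x
  proof (cases "x < n")
    case True
    have "x \<in> nbrs (cycle_graph n) v \<longleftrightarrow> x = (v + 1) mod n \<or> v = (x + 1) mod n"
      using True assms(2) by (simp add: nbrs_def cycle_graph_def)
    then show ?thesis
      unfolding succ[OF True] succ[OF assms(2)] using True by blast
  qed (simp add: nbrs_def cycle_graph_def)
  show ?thesis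
  proof (rule set_eqI)
    fix x
    show "x \<in> nbrs (cycle_graph n) v \<longleftrightarrow>
        x \<in> {if v + 1 = n then 0 else v + 1, if v = 0 then n - 1 else v - 1}"
      unfolding iff insert_iff empty_iff using assms
      by (cases "x + 1 = n"; cases "v + 1 = n"; cases "v = 0") (simp_all, linarith+)
  qed
qed

text \<open>
  The two neighbours of a vertex are at distance two from each other and exactly one of them is in \<open>A\<close>.
  Going from 0 to \<open>n - 2\<close> in steps of two makes an even number of flips if \<open>n\<close> is congruent to 2 modulo 4,
  and the step from \<open>n - 2\<close> to 0 would be one more.
\<close>

lemma cycle_perfect_not_2_mod_4:
  assumes "n \<ge> 3" and one: "\<And>v. v < n \<Longrightarrow> card (nbrs (cycle_graph n) v \<inter> A) = 1"
  shows "n mod 4 \<noteq> 2"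
proof
  assume n: "n mod 4 = 2"
  have xor: "x \<in> A \<longleftrightarrow> y \<notin> A" if "v < n" "nbrs (cycle_graph n) v = {x, y}" "x \<noteq> y" for v x y
    using one[OF that(1)] that(2,3) by (cases "x \<in> A"; cases "y \<in> A") auto
  have step: "v \<in> A \<longleftrightarrow> v + 2 \<notin> A" if "v + 2 < n" for v
    using that by (intro xor[of "v + 1"]) (auto simp: nbrs_cycle_graph assms(1))
  have flip: "2 * m < n \<Longrightarrow> 2 * m \<in> A \<longleftrightarrow> (0 \<in> A \<longleftrightarrow> even m)" for m
  proof (induction m)
    case (Suc m)
    then have "2 * m \<in> A \<longleftrightarrow> (0 \<in> A \<longleftrightarrow> even m)" "2 * m \<in> A \<longleftrightarrow> 2 * Suc m \<notin> A"
      using step[of "2 * m"] by simp_all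
    then show ?case by auto
  qed simp
  (* n - 2 is twice an even number, so flip identifies its membership with that of 0 *)
  have "2 * (2 * (n div 4)) = n - 2" using n by presburger
  then have "n - 2 \<in> A \<longleftrightarrow> 0 \<in> A"
    using flip[of "2 * (n div 4)"] assms(1) by simp
  moreover have "n - 2 \<in> A \<longleftrightarrow> 0 \<notin> A"
    using assms(1) by (intro xor[of "n - 1"]) (auto simp: nbrs_cycle_graph)
  ultimately show False by simp
qed

lemma card_ge_myc_value_cycle:
  assumes "n \<ge> 3" and "secure_dominating_set (mycielskian (cycle_graph n)) S"
  shows "myc_value n \<le> card S"
proof -
  have V: "pverts (cycle_graph n) = {..<n}"
    by (simp add: cycle_graph_def)
  interpret pair_graph "cycle_graph n"
    using assms(1) by (rule pair_graph_cycle_graph)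
  interpret mycielskian_secure_2_regular "cycle_graph n" S
  proof unfold_locales
    show "secure_dominating_set (mycielskian (cycle_graph n)) S" by fact
    show "card (nbrs (cycle_graph n) v) = 2" if "v \<in> pverts (cycle_graph n)" for v
      using that assms(1) by (auto simp: V nbrs_cycle_graph)
  qed
  have "n + 2 \<le> 2 * card S"
    using card_lower_bound assms(1) V by simp
  moreover have "2 * card S \<noteq> n + 2" if "n mod 4 = 2"
  proof
    assume tight: "2 * card S = n + 2"
    have n: "n > 5" using that assms(1) by presburger
    have nbrs_iff: "y \<in> nbrs (cycle_graph n) x \<longleftrightarrow> x < n \<and> y < n \<and>
        (y = x + 1 \<or> x = y + 1 \<or> (x + 1 = n \<and> y = 0) \<or> (y + 1 = n \<and> x = 0))" for x y
    proof (cases "x < n")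
      case True
      show ?thesis
        unfolding nbrs_cycle_graph[OF assms(1) True] using assms(1) True
        by (cases "x + 1 = n"; cases "x = 0") (simp_all, linarith+)
    qed (simp add: nbrs_def cycle_graph_def)
    have "d v = 1" if "v < n" for v
    proof (rule tight_perfect)
      show "nbrs (cycle_graph n) x \<inter> nbrs (cycle_graph n) y = {}"
        if "y \<in> nbrs (cycle_graph n) x" for x y
      proof (rule ccontr)
        assume "\<not> ?thesis"
        then obtain p where p: "p \<in> nbrs (cycle_graph n) x" "p \<in> nbrs (cycle_graph n) y"
          by blast
        show False
          using that p n unfolding nbrs_iff by (elim conjE disjE) linarith+
      qed
      show "p = q" if "x \<noteq> y" "p \<in> nbrs (cycle_graph n) x \<inter> nbrs (cycle_graph n) y"
        "q \<in> nbrs (cycle_graph n) x \<inter> nbrs (cycle_graph n) y" for x y p q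
      proof -
        \<comment> \<open>A common neighbour lies between the two, possibly across the wrap-around at 0.\<close>
        have common: "(y = x + 2 \<and> p = x + 1) \<or> (x = 0 \<and> y = n - 2 \<and> p = n - 1) \<or>
            (x = 1 \<and> y = n - 1 \<and> p = 0)"
          if "x < y" "p \<in> nbrs (cycle_graph n) x" "p \<in> nbrs (cycle_graph n) y" for x y p
          using that unfolding nbrs_iff by (elim conjE disjE) linarith+
        have "p = q" if "x < y" "p \<in> nbrs (cycle_graph n) x" "p \<in> nbrs (cycle_graph n) y"
          "q \<in> nbrs (cycle_graph n) x" "q \<in> nbrs (cycle_graph n) y" for x y p q
          using common[OF that(1,2,3)] common[OF that(1,4,5)] n by (elim conjE disjE) linarith+
        then show ?thesis
          using that by (metis IntE linorder_neqE_nat)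
      qed
    qed (use tight n that V in auto)
    then show False
      using cycle_perfect_not_2_mod_4[OF assms(1)] \<open>n mod 4 = 2\<close> by blast
  qed
  ultimately show ?thesis
    unfolding myc_value_def Let_def by presburger
qed

section \<open>Paths\<close>

text \<open>
  While the apex stays, it dominates all twins, and \<open>G\<close> alone decides about the originals. When the
  apex moves to a twin, that twin dominates the apex, and by totality \<open>T\<close> dominates all originals and
  twins.
\<close>

lemma secure_dominating_set_mycielskian:
  assumes "pverts G \<noteq> {}"
    and "secure_dominating_set G T"
    and total: "\<And>x. x \<in> pverts G \<Longrightarrow> nbrs G x \<inter> T \<noteq> {}"
  shows "secure_dominating_set (mycielskian G) (insert Apex (Orig ` T))"
proof -
  have TV: "T \<subseteq> pverts G" and secure: "\<And>x. x \<in> pverts G - T \<Longrightarrow>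
      \<exists>y\<in>T. (x, y) \<in> parcs G \<and> dominating_set G (T - {y} \<union> {x})"
    using assms(2) by (auto simp: secure_dominating_set_def dominating_set_def)
  have lift: "dominating_set (mycielskian G) (insert Apex (Orig ` D))" if "dominating_set G D" for D
    unfolding dominating_set_mycielskian_iff
    using that by (auto simp: dominating_set_def nbrs_def pverts_mycielskian image_iff; blast)
  have "\<exists>v\<in>insert Apex (Orig ` T). (u, v) \<in> parcs (mycielskian G) \<and>
      dominating_set (mycielskian G) (insert Apex (Orig ` T) - {v} \<union> {u})"
    if u: "u \<in> pverts (mycielskian G) - insert Apex (Orig ` T)" for u
  proof (cases u)
    case (Orig x)
    then have "x \<in> pverts G - T" using u by (auto simp: pverts_mycielskian)
    then obtain y where y: "y \<in> T" "(x, y) \<in> parcs G" "dominating_set G (T - {y} \<union> {x})"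
      using secure by blast
    have "insert Apex (Orig ` T) - {Orig y} \<union> {u} = insert Apex (Orig ` (T - {y} \<union> {x}))"
      using Orig by auto
    then have "dominating_set (mycielskian G) (insert Apex (Orig ` T) - {Orig y} \<union> {u})"
      using lift[OF y(3)] by (simp only:)
    moreover have "Orig y \<in> insert Apex (Orig ` T)" "(u, Orig y) \<in> parcs (mycielskian G)"
      using y(1,2) Orig by simp_all
    ultimately show ?thesis by blast
  next
    case (Twin x)
    then have x: "x \<in> pverts G" using u by (auto simp: pverts_mycielskian)
    have nbr: "\<exists>y\<in>nbrs G z. Orig y \<in> insert (Twin x) (Orig ` T)" if "z \<in> pverts G" for z
      using total[OF that] by auto
    have "dominating_set (mycielskian G) (insert (Twin x) (Orig ` T))"
      unfolding dominating_set_mycielskian_iff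
    proof (intro conjI ballI)
      show "insert (Twin x) (Orig ` T) \<subseteq> pverts (mycielskian G)"
        using x TV by (auto simp: pverts_mycielskian)
    qed (use nbr x in blast)+
    also have "insert (Twin x) (Orig ` T) = insert Apex (Orig ` T) - {Apex} \<union> {u}"
      using Twin by auto
    finally show ?thesis
      using x Twin by (intro bexI[of _ Apex]) auto
  next
    case Apex
    then show ?thesis using u by simp
  qed
  moreover have "dominating_set G T"
    using assms(2) by (simp add: secure_dominating_set_def)
  ultimately show ?thesis
    using lift by (simp add: secure_dominating_set_def)
qed

text \<open>
  The vertex \<open>n - 2\<close> is needed as a neighbour of the last vertex; it already belongs to the periodic
  part if \<open>n\<close> is congruent to 0 or 3 modulo 4.
\<close>

definition path_set :: "nat \<Rightarrow> nat set" where
  "path_set n = insert (n - 2) {i. i < n \<and> i mod 4 \<in> {1, 2}}"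

lemma card_path_set:
  assumes "n \<ge> 2"
  shows "card (path_set n) + 1 = myc_value n"
proof -
  have "card {i. i < m \<and> i mod 4 \<in> {1, 2}} = 2 * (m div 4) + (m mod 4 - 1)" for m :: nat
  proof (induction m)
    case (Suc m)
    have "{i. i < Suc m \<and> i mod 4 \<in> {1, 2}} =
        (if m mod 4 \<in> {1, 2} then insert m {i. i < m \<and> i mod 4 \<in> {1, 2}}
         else {i. i < m \<and> i mod 4 \<in> {1, 2}})"
      by (auto simp: less_Suc_eq)
    then have "card {i. i < Suc m \<and> i mod 4 \<in> {1, 2}} =
        2 * (m div 4) + (m mod 4 - 1) + of_bool (m mod 4 \<in> {1, 2})"
      using Suc by simp
    also have "\<dots> = 2 * (Suc m div 4) + (Suc m mod 4 - 1)"
    proof -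
      have "m mod 4 < 4" by simp
      then consider "m mod 4 = 0" | "m mod 4 = 1" | "m mod 4 = 2" | "m mod 4 = 3" by linarith
      then show ?thesis by cases (auto simp: mod_Suc div_Suc)
    qed
    finally show ?case .
  qed simp
  then have "card (path_set n) =
      2 * (n div 4) + (n mod 4 - 1) + of_bool ((n - 2) mod 4 \<notin> {1, 2})"
    using assms by (simp add: path_set_def card_insert_if)
  also have "\<dots> + 1 = myc_value n"
  proof -
    from assms obtain m where m: "n = 2 + m" using le_Suc_ex by blast
    have "m mod 4 < 4" by simp
    then consider "m mod 4 = 0" | "m mod 4 = 1" | "m mod 4 = 2" | "m mod 4 = 3" by linarith
    then show ?thesis by cases (auto simp: m mod_Suc div_Suc myc_value_def)
  qed
  finally show ?thesis .
qed

lemma path_set_total: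
  assumes "n \<ge> 2" "i < n"
  shows "nbrs (path_graph n) i \<inter> path_set n \<noteq> {}"
proof -
  have "i mod 4 \<in> {0, 1, 2, 3}" by auto
  moreover have "i + 1 < n \<or> i = n - 1" using assms by linarith
  ultimately consider "i mod 4 \<in> {0, 1}" "i + 1 < n" | "i = n - 1" | "i mod 4 \<in> {2, 3}"
    by blast
  then have "\<exists>j\<in>path_set n. j < n \<and> (j = i + 1 \<or> i = j + 1)"
  proof cases
    case 1
    then have "(i + 1) mod 4 \<in> {1, 2}" by (auto simp: mod_Suc)
    then show ?thesis using 1 by (auto simp: path_set_def)
  next
    case 2
    then show ?thesis using assms by (intro bexI[of _ "n - 2"]) (auto simp: path_set_def)
  next
    case 3
    then have "i = i - 1 + 1" "(i - 1) mod 4 \<in> {1, 2}"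
      by (cases i; auto simp: mod_Suc split: if_splits)+
    then show ?thesis using assms 3 by (intro bexI[of _ "i - 1"]) (auto simp: path_set_def)
  qed
  then show ?thesis
    using assms by (auto simp: nbrs_def path_graph_def)
qed

text \<open>
  A vertex \<open>x\<close> outside \<open>path_set n\<close> is defended by a neighbour \<open>y\<close> whose other neighbour, if any, is in
  \<open>path_set n\<close>: then nothing except \<open>x\<close> and \<open>y\<close> depends on \<open>y\<close>, and \<open>y\<close> is afterwards dominated by
  \<open>x\<close>. This \<open>y\<close> is the nearest vertex of the same block, or \<open>n - 2\<close> if \<open>x\<close> is the last vertex.
\<close>

lemma path_set_secure:
  assumes "n \<ge> 2"
  shows "secure_dominating_set (path_graph n) (path_set n)"
proof -
  have V: "pverts (path_graph n) = {..<n}" by (simp add: path_graph_def)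
  have sub: "path_set n \<subseteq> pverts (path_graph n)"
    using assms by (auto simp: path_set_def V)
  have total: "\<exists>y\<in>path_set n. (x, y) \<in> parcs (path_graph n)" if "x < n" for x
    using path_set_total[OF assms that] by (auto simp: nbrs_def)
  have dom: "dominating_set (path_graph n) (path_set n)"
    using sub total by (auto simp: dominating_set_def V)
  have "\<exists>y\<in>path_set n. (x, y) \<in> parcs (path_graph n) \<and>
      dominating_set (path_graph n) (path_set n - {y} \<union> {x})"
    if x: "x \<in> pverts (path_graph n) - path_set n" for x
  proof -
    have xn: "x < n" "x mod 4 \<notin> {1, 2}" "x \<noteq> n - 2"
      using x by (auto simp: V path_set_def)
    have "\<exists>y\<in>path_set n. (x, y) \<in> parcs (path_graph n) \<and>
        (\<forall>z. (z, y) \<in> parcs (path_graph n) \<longrightarrow> z \<in> insert x (path_set n))"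
    proof (cases "x mod 4 = 0 \<and> x + 1 < n")
      case True
      then have "(x + 1) mod 4 = 1" "(x + 2) mod 4 = 2" by (simp_all add: mod_Suc)
      then show ?thesis
        using True by (intro bexI[of _ "x + 1"]) (auto simp: path_set_def path_graph_def)
    next
      case False
      have "x mod 4 < 4" by simp
      then have "x mod 4 = 3 \<or> x = n - 1 \<and> x mod 4 = 0"
        using False xn by auto
      then have y: "x \<ge> 1 \<and> x - 1 \<in> path_set n" and z: "x \<ge> 2 \<longrightarrow> x - 2 \<in> path_set n"
      proof (atomize (full), elim disjE)
        assume "x mod 4 = 3"
        then obtain k where "x = 4 * k + 3" by (metis mult_div_mod_eq)
        then have "x \<ge> 2" "(x - 1) mod 4 = 2" "(x - 2) mod 4 = 1" by (simp_all add: mod_Suc)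
        then show "(x \<ge> 1 \<and> x - 1 \<in> path_set n) \<and> (x \<ge> 2 \<longrightarrow> x - 2 \<in> path_set n)"
          using xn by (auto simp: path_set_def)
      next
        assume last: "x = n - 1 \<and> x mod 4 = 0"
        have "(x - 2) mod 4 = 2" if "x \<ge> 2"
        proof -
          from that obtain m where m: "x = 2 + m" using le_Suc_ex by blast
          have "x mod 4 = 0" using last by blast
          then show ?thesis unfolding m by (auto simp: mod_Suc split: if_splits)
        qed
        then show "(x \<ge> 1 \<and> x - 1 \<in> path_set n) \<and> (x \<ge> 2 \<longrightarrow> x - 2 \<in> path_set n)"
          using last assms by (auto simp: path_set_def)
      qed
      show ?thesis
      proof (intro bexI[of _ "x - 1"] conjI allI impI)
        show "(x, x - 1) \<in> parcs (path_graph n)"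
          using xn y by (auto simp: path_graph_def)
        fix v assume "(v, x - 1) \<in> parcs (path_graph n)"
        then have "v = x \<or> x \<ge> 2 \<and> v = x - 2"
          using y by (auto simp: path_graph_def)
        then show "v \<in> insert x (path_set n)" using z by auto
      qed (use y in simp)
    qed
    then obtain y where y: "y \<in> path_set n" "(x, y) \<in> parcs (path_graph n)"
      "\<And>z. (z, y) \<in> parcs (path_graph n) \<Longrightarrow> z \<in> insert x (path_set n)" by blast
    have "dominating_set (path_graph n) (path_set n - {y} \<union> {x})"
      unfolding dominating_set_def
    proof (intro conjI ballI)
      show "path_set n - {y} \<union> {x} \<subseteq> pverts (path_graph n)"
        using sub x by auto
      fix z assume z: "z \<in> pverts (path_graph n) - (path_set n - {y} \<union> {x})"
      show "\<exists>v\<in>path_set n - {y} \<union> {x}. (z, v) \<in> parcs (path_graph n)"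
      proof (cases "z = y")
        case True
        then show ?thesis using y(2) by (auto simp: path_graph_def)
      next
        case False
        then obtain v where "v \<in> path_set n" "(z, v) \<in> parcs (path_graph n)"
          using total[of z] z V by auto
        then show ?thesis using y(3)[of z] z False by auto
      qed
    qed
    then show ?thesis using y by blast
  qed
  then show ?thesis
    using dom by (simp add: secure_dominating_set_def)
qed

text \<open>
  The single vertex is isolated and has no totally dominating set; its original and the apex work.
\<close>

lemma ex_secure_dominating_set_path:
  assumes "n \<ge> 1"
  shows "\<exists>S. secure_dominating_set (mycielskian (path_graph n)) S \<and> card S = myc_value n"
proof (cases "n = 1")
  case True
  have G: "pverts (path_graph 1) = {0}" "\<And>x. nbrs (path_graph 1) x = {}"
    by (auto simp: path_graph_def nbrs_def)
  let ?S = "{Orig 0, Apex}"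
  have "secure_dominating_set (mycielskian (path_graph 1)) ?S"
    unfolding secure_dominating_set_def dominating_set_mycielskian_iff pverts_mycielskian G
    by (auto simp: G[unfolded One_nat_def])
  moreover have "card ?S = myc_value 1"
    by (simp add: myc_value_def)
  ultimately show ?thesis using True by blast
next
  case False
  then have n: "n \<ge> 2" using assms by simp
  have "secure_dominating_set (mycielskian (path_graph n)) (insert Apex (Orig ` path_set n))"
  proof (rule secure_dominating_set_mycielskian)
    show "pverts (path_graph n) \<noteq> {}" using assms by (simp add: path_graph_def lessThan_empty_iff)
    show "nbrs (path_graph n) x \<inter> path_set n \<noteq> {}" if "x \<in> pverts (path_graph n)" for x
      using that path_set_total[OF n] by (simp add: path_graph_def)
  qed (rule path_set_secure[OF n])
  moreover have "card (insert Apex (Orig ` path_set n)) = myc_value n"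
  proof -
    have "finite (path_set n)" by (simp add: path_set_def)
    then have "card (insert Apex (Orig ` path_set n)) = card (Orig ` path_set n) + 1"
      by (subst card_insert_disjoint) auto
    also have "card (Orig ` path_set n) = card (path_set n)"
      by (rule card_image) (simp add: inj_on_def)
    finally show ?thesis using card_path_set[OF n] by simp
  qed
  ultimately show ?thesis by blast
qed

lemma card_ge_myc_value_path_1:
  assumes "secure_dominating_set (mycielskian (path_graph 1)) S"
  shows "myc_value 1 \<le> card S"
proof -
  have G: "pverts (path_graph 1) = {0}" "\<And>x. nbrs (path_graph 1) x = {}"
    by (auto simp: path_graph_def nbrs_def)
  have "dominating_set (mycielskian (path_graph 1)) S"
    using assms by (simp only: secure_dominating_set_def)
  then have S: "S \<subseteq> {Orig 0, Twin 0, Apex}" "Orig 0 \<in> S" "Twin 0 \<in> S \<or> Apex \<in> S"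
    unfolding dominating_set_mycielskian_iff pverts_mycielskian G by blast+
  then obtain x where "{Orig 0, x} \<subseteq> S" "x \<noteq> Orig 0" by blast
  moreover have "finite S" using S(1) finite_subset by auto
  ultimately have "card {Orig 0, x} \<le> card S" by (intro card_mono)
  then show ?thesis using \<open>x \<noteq> Orig 0\<close> by (simp add: myc_value_def)
qed

text \<open>
  The Mycielskian of a single edge is a 5-cycle. The proof records membership of its five vertices in
  \<open>S\<close> by truth values; \<open>D\<close> is domination in the 5-cycle, and each vertex is in \<open>S\<close> or is defended
  by one of its two neighbours.
\<close>

lemma card_ge_myc_value_path_2:
  assumes "secure_dominating_set (mycielskian (path_graph 2)) S"
  shows "myc_value 2 \<le> card S"
proof -
  let ?M = "mycielskian (path_graph 2)"
  have V: "pverts (path_graph 2) = {0, 1}"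
    and N: "nbrs (path_graph 2) 0 = {1}" "nbrs (path_graph 2) 1 = {0}"
    by (auto simp: path_graph_def nbrs_def)
  define D where "D o0 o1 t0 t1 w \<longleftrightarrow> (o0 \<or> o1 \<or> t1) \<and> (o1 \<or> o0 \<or> t0) \<and>
      (t0 \<or> w \<or> o1) \<and> (t1 \<or> w \<or> o0) \<and> (w \<or> t0 \<or> t1)" for o0 o1 t0 t1 w
  let ?D = "\<lambda>T. D (Orig 0 \<in> T) (Orig 1 \<in> T) (Twin 0 \<in> T) (Twin 1 \<in> T) (Apex \<in> T)"
  have dom: "?D T" if "dominating_set ?M T" for T
    using that unfolding dominating_set_mycielskian_iff V D_def
    by (simp only: ball_simps bex_simps N) blast
  have swap: "u \<in> S \<or> (a \<in> S \<and> ?D (S - {a} \<union> {u})) \<or> (b \<in> S \<and> ?D (S - {b} \<union> {u}))"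
    if "u \<in> pverts ?M" "\<And>v. (u, v) \<in> parcs ?M \<Longrightarrow> v = a \<or> v = b" for u a b
    using assms that dom unfolding secure_dominating_set_def by blast
  have arc: "(x, y) \<in> parcs (path_graph 2) \<longleftrightarrow> (x = 0 \<and> y = 1) \<or> (x = 1 \<and> y = 0)" for x y
    by (auto simp: path_graph_def)
  define o0 o1 t0 t1 w where mem: "o0 = (Orig 0 \<in> S)" "o1 = (Orig 1 \<in> S)"
    "t0 = (Twin 0 \<in> S)" "t1 = (Twin 1 \<in> S)" "w = (Apex \<in> S)"
  have "D o0 o1 t0 t1 w"
    unfolding mem by (rule dom) (use assms in \<open>simp only: secure_dominating_set_def\<close>)
  moreover have "o0 \<or> (o1 \<and> D True False t0 t1 w) \<or> (t1 \<and> D True o1 t0 False w)"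
    using swap[of "Orig 0" "Orig 1" "Twin 1"] unfolding mem mycielskian_def by (auto simp: V arc)
  moreover have "o1 \<or> (o0 \<and> D False True t0 t1 w) \<or> (t0 \<and> D o0 True False t1 w)"
    using swap[of "Orig 1" "Orig 0" "Twin 0"] unfolding mem mycielskian_def by (auto simp: V arc)
  moreover have "t0 \<or> (o1 \<and> D o0 False True t1 w) \<or> (w \<and> D o0 o1 True t1 False)"
    using swap[of "Twin 0" "Orig 1" Apex] unfolding mem mycielskian_def by (auto simp: V arc)
  moreover have "t1 \<or> (o0 \<and> D False o1 t0 True w) \<or> (w \<and> D o0 o1 t0 True False)"
    using swap[of "Twin 1" "Orig 0" Apex] unfolding mem mycielskian_def by (auto simp: V arc)
  moreover have "w \<or> (t0 \<and> D o0 o1 False t1 True) \<or> (t1 \<and> D o0 o1 t0 False True)"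
    using swap[of Apex "Twin 0" "Twin 1"] unfolding mem mycielskian_def by (auto simp: V arc)
  ultimately have "of_bool o0 + of_bool o1 + (of_bool t0 + of_bool t1) + of_bool w \<ge> (3 :: nat)"
    unfolding D_def by (cases o0; cases o1; cases t0; cases t1; cases w) simp_all
  also have "\<dots> = (\<Sum>v\<in>{Orig 0, Orig 1, Twin 0, Twin 1, Apex}. of_bool (v \<in> S))"
    by (simp add: mem)
  also have "\<dots> = card (S \<inter> {Orig 0, Orig 1, Twin 0, Twin 1, Apex})"
    by (simp only: sum_of_bool_eq finite.intros Int_def mem_Collect_eq conj_commute) simp
  also have "S \<inter> {Orig 0, Orig 1, Twin 0, Twin 1, Apex} = S"
    using assms
    by (auto simp: secure_dominating_set_def dominating_set_def pverts_mycielskian V)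
  finally show ?thesis by (simp add: myc_value_def)
qed

lemma secure_domination_number_eqI:
  assumes "finite (pverts G)" and "secure_dominating_set G S" and "card S = m"
    and "\<And>T. secure_dominating_set G T \<Longrightarrow> m \<le> card T"
  shows "secure_domination_number G = m"
  using secure_domination_number_attained[OF assms(1)] assms(2-4) by (metis le_antisym)

lemma path_secure_imp_cycle_secure:
  assumes "n \<ge> 3" and "secure_dominating_set (mycielskian (path_graph n)) S"
  shows "secure_dominating_set (mycielskian (cycle_graph n)) S"
proof (rule secure_dominating_set_spanning_subgraph)
  show "parcs (mycielskian (path_graph n)) \<subseteq> parcs (mycielskian (cycle_graph n))"
    by (auto simp: mycielskian_def path_graph_def cycle_graph_def)
qed (use assms in \<open>auto simp: pverts_mycielskian path_graph_def cycle_graph_def\<close>)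

theorem theorem3p1:
  shows "(\<forall>n::nat. n \<ge> 1 \<longrightarrow>
            secure_domination_number (mycielskian (path_graph n)) = myc_value n) \<and>
         (\<forall>n::nat. n \<ge> 3 \<longrightarrow>
            secure_domination_number (mycielskian (cycle_graph n)) = myc_value n) \<and>
         (\<forall>n::nat. n \<ge> 3 \<longrightarrow>
            secure_domination_number (mycielskian (path_graph n)) =
            secure_domination_number (mycielskian (cycle_graph n)))"
proof -
  have fin: "finite (pverts (mycielskian (path_graph n)))"
    "finite (pverts (mycielskian (cycle_graph n)))" for n
    by (simp_all add: pverts_mycielskian path_graph_def cycle_graph_def)
  have path: "secure_domination_number (mycielskian (path_graph n)) = myc_value n"
    if n: "n \<ge> 1" for n
  proof -
    obtain S where S: "secure_dominating_set (mycielskian (path_graph n)) S" "card S = myc_value n"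
      using ex_secure_dominating_set_path[OF n] by blast
    have "myc_value n \<le> card T" if "secure_dominating_set (mycielskian (path_graph n)) T" for T
    proof -
      consider "n = 1" | "n = 2" | "n \<ge> 3" using n by linarith
      then show ?thesis
        using that card_ge_myc_value_path_1 card_ge_myc_value_path_2
          card_ge_myc_value_cycle path_secure_imp_cycle_secure by cases auto
    qed
    with fin(1) S show ?thesis by (rule secure_domination_number_eqI)
  qed
  have cycle: "secure_domination_number (mycielskian (cycle_graph n)) = myc_value n"
    if n: "n \<ge> 3" for n
  proof -
    obtain S where S: "secure_dominating_set (mycielskian (path_graph n)) S" "card S = myc_value n"
      using ex_secure_dominating_set_path[of n] n by auto
    from fin(2) path_secure_imp_cycle_secure[OF n S(1)] S(2) card_ge_myc_value_cycle[OF n]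
    show ?thesis by (rule secure_domination_number_eqI)
  qed
  show ?thesis using path cycle by simp
qed

end
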